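(* Let $\xi=(L^\xi,\Delta_0^\xi,B^\xi,d,G)$ be a generic configuration. The function $G^\xi_1$ is consistency preserving when $\xi$ is EA-stable. Likewise the function $G^\xi_0$ is consistency preserving when $\xi$ is any one of A-stable, E-stable or 0-stable. (Thus in each case $G^\xi_k(\theta)$ is consistent whenever $\theta$ is an r.e. set of $\Pi_1^\xi$ sentences all of which are true in the Standard-M model.)
   Context: **Generic configurations.** Standard-M is the standard model of the natural numbers. $\mathrm{Log}$ is the base-2 logarithm. A generic configuration $\xi$ is a 5-tuple $(L^\xi,\Delta_0^\xi,B^\xi,d,G)$ where: (1) $L^\xi$ is a language with symbols for $0,1,2,=,\le$ and $\mathrm{Maximum}(x,y)$, and enough function and constant symbols that every integer $k$ is the value of some term $T_k$. (2) $\Delta_0^\xi$ is a fixed class of fully bounded $L^\xi$-formulas (all quantifiers have the form $\exists v\le T$ or $\forall v\le T$ with $T$ a term), closed under negation, and rich enough to contain two formulas $\mathrm{Add}(x,y,z)$ and $\mathrm{Mult}(x,y,z)$ defining the graphs of addition and multiplication. Every $\Delta_0^\xi$ formula is both $\Pi_0^\xi$ and $\Sigma_0^\xi$; for $n\ge1$ a formula is $\Pi_n^\xi$ (resp. $\Sigma_n^\xi$) iff it can be written $\forall v_1\cdots\forall v_k\,\Phi$ with $\Phi\in\Sigma_{n-1}^\xi$ (resp. $\exists v_1\cdots\exists v_k\,\Phi$ with $\Phi\in\Pi_{n-1}^\xi$); $\Delta_0^\xi$ sentences count as both $\Pi_1^\xi$ and $\Sigma_1^\xi$. (3) $B^\xi$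 (the base axiom system) is an axiom system whose axioms are true in Standard-M and which is $\Sigma_1^\xi$-complete: it proves every true $\Sigma_1^\xi$ sentence and refutes every false $\Pi_1^\xi$ sentence. (4) $d$ is a deduction method, conventional enough to satisfy the indirect-implication property associated with Gödel's Completeness Theorem: whether or not modus ponens is built in, whenever it can prove $X$, $Y$ and $(X\wedge Y)\to Z$, it can prove $Z$ (possibly by a much longer proof). (5) $G$ is a method for encoding the Gödel numbers of proofs. Proofs are identified with their Gödel numbers $p$. **Goodness.** $E(N)$ is a term of value $2^N$. For a prenex sentence $\Upsilon$, $\mathrm{Scope}_E(\Upsilon,N)$ is obtained from $\Upsilon$ by replacing each unbounded $\forall v$ by $\forall v<E(N)$ and each unbounded $\exists v$ by $\exists v<E(N)$, leaving the bounded quantifiers of the $\Delta_0^\xi$ part unchanged. A $\Pi_1^\xi$ or $\Sigma_1^\xi$ sentence $\Upsilon$ is $\mathrm{Good}(N)$ when $\mathrm{Scope}_E(\Upsilon,N)$ is true in Standard-M ($\mathrm{Good}(\infty)$ means true in Standard-M). For a set $\theta$ of $\Pi_1^\xi$ sentences, $\sharp(\theta)$ is the largest integer $J$ such that every sentence of $\theta$ is $\mathrm{Good}(J)$, and $\sharp(\theta)=\infty$ if this holds for all $J$. **Stability.** $\mathrm{RE\text{-}Class}(\xi)$ is the set of all recursively enumerable sets $\theta$ of $\Pi_1^\xi$ sentences (true or not). - $\xi$ is A-stable iff for every $\theta\in\mathrm{RE\text{-}Class}(\xi)$: if $\Upsilon$ is a $\Pi_1^\xi$ theorem of $\theta\cup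 B^\xi$ via a proof $p$ with $\mathrm{Log}(p)\le\sharp(\theta)+1$, then $\Upsilon$ is $\mathrm{Good}\{\tfrac12\sharp(\theta)\}$. - $\xi$ is E-stable iff for every $\theta\in\mathrm{RE\text{-}Class}(\xi)$: if $\Upsilon$ is a $\Sigma_1^\xi$ theorem of $\theta\cup B^\xi$ via a proof $p$ with $\mathrm{Log}(p)\le\sharp(\theta)+1$, then $\Upsilon$ is $\mathrm{Good}\{\tfrac12\lfloor\mathrm{Log}(p)\rfloor-1\}$. - $\xi$ is EA-stable iff it is both E-stable and A-stable. - $\xi$ is 0-stable iff for every $\theta\in\mathrm{RE\text{-}Class}(\xi)$: if $\Upsilon$ is a $\Delta_0^\xi$ theorem of $\theta\cup B^\xi$ via a proof $p$ with $\mathrm{Log}(p)\le\sharp(\theta)+1$, then $\Upsilon$ is true in Standard-M. **Self-consistency axioms.** An axiom system $\alpha\supseteq B^\xi$ is Level$(k^\xi)$ consistent when there are no proofs from $\alpha$ via $d$ of both a $\Pi_k^\xi$ sentence and the $\Sigma_k^\xi$ sentence that is its negation. For $\beta\supseteq B^\xi$, $\mathrm{SelfCons}^k(\beta,d)$ is a self-referencing $\Pi_1^\xi$ sentence asserting the Level$(k^\xi)$ consistency of $\beta+\mathrm{SelfCons}^k(\beta,d)$. Explicitly, use $\Delta_0^\xi$ formulas: $\mathrm{Neg}^k(x,y)$: $x$ is the Gödel number of a $\Pi_k^\xi$ sentence and $y$ that of the $\Sigma_k^\xi$ sentence which is its negation; $\mathrm{SubstPrf}^d_\beta(g,t,p)$: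 there is $h$ such that $h$ encodes the sentence obtained from the formula with code $g$ by replacing its free variables by the numeral $\bar g$, and $p$ is a proof of $t$ via $d$ from $\beta$ together with the sentence coded by $h$. Let $\Gamma^k(g)$ be $\forall x\forall y\forall p\forall q\ \neg\{\mathrm{Neg}^k(x,y)\wedge\mathrm{SubstPrf}^d_\beta(g,x,p)\wedge\mathrm{SubstPrf}^d_\beta(g,y,q)\}$ and $n$ its Gödel number; then $\mathrm{SelfCons}^k(\beta,d)$ is $\Gamma^k(\bar n)$. **The functions $G^\xi_k$.** For $k\in\{0,1\}$ and an r.e. set $\theta$ of $\Pi_1^\xi$ sentences (not required to be true), $$G^\xi_k(\theta)=\theta\cup B^\xi\cup\mathrm{SelfCons}^k\{[\theta\cup B^\xi],d\}.$$ The function $G^\xi_k$ (mapping $\theta$ to $G^\xi_k(\theta)$) is consistency preserving iff $G^\xi_k(\theta)$ is consistent whenever all the sentences in $\theta$ are true in Standard-M. *)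

theory Defs
  imports Complex_Main "HOL-Library.Extended_Real" "HOL-Library.Nat_Bijection"
begin

section \<open>Recursively enumerable sets of natural numbers\<close>

text \<open>Partial recursive functions as codes with a big-step evaluation relation. Arguments are
  passed as lists; in \<open>Pr f g\<close> the recursion argument is the first one, and \<open>g\<close> receives the
  predecessor followed by the previous value; \<open>Mn f\<close> is unbounded minimisation over the first
  argument of \<open>f\<close>.\<close>

datatype recf = Zero | Succ | Proj nat | Cn recf "recf list" | Pr recf recf | Mn recf

inductive rec_eval :: "recf \<Rightarrow> nat list \<Rightarrow> nat \<Rightarrow> bool" where
  "rec_eval Zero xs 0"
| "rec_eval Succ [x] (Suc x)"
| "i < length xs \<Longrightarrow> rec_eval (Proj i) xs (xs ! i)"
| "list_all2 (\<lambda>g y. rec_eval g xs y) gs ys \<Longrightarrow> rec_eval f ys z \<Longrightarrow> rec_eval (Cn f gs) xs z"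
| "rec_eval f xs y \<Longrightarrow> rec_eval (Pr f g) (0 # xs) y"
| "rec_eval (Pr f g) (n # xs) r \<Longrightarrow> rec_eval g (n # r # xs) y \<Longrightarrow> rec_eval (Pr f g) (Suc n # xs) y"
| "rec_eval f (n # xs) 0 \<Longrightarrow> (\<forall>m<n. \<exists>y. rec_eval f (m # xs) (Suc y)) \<Longrightarrow> rec_eval (Mn f) xs n"

definition re_set :: "nat set \<Rightarrow> bool" where
  "re_set A \<longleftrightarrow> (\<exists>f. A = {x. \<exists>y. rec_eval f [x] y})"


section \<open>Terms and formulas\<close>

text \<open>Variables are de Bruijn indices. Bounded quantifiers are constructors of their own:
  \<open>BAll t \<phi>\<close> is ``for all v \<open>\<le>\<close> t, \<open>\<phi>\<close>'' with \<open>v\<close> the variable 0 of \<open>\<phi>\<close>; the bound \<open>t\<close> lies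
  outside the scope of the quantifier, so it cannot mention \<open>v\<close>. Function and relation symbols
  are named by natural numbers.\<close>

datatype tm = Var nat | Fn nat "tm list"

datatype fm =
    Eq tm tm | Le tm tm | Rel nat "tm list"
  | Neg fm | Con fm fm | Dis fm fm | Imp fm fm
  | BAll tm fm | BEx tm fm | All fm | Ex fm

fun tm_vars :: "tm \<Rightarrow> nat set" where
  "tm_vars (Var n) = {n}"
| "tm_vars (Fn f ts) = (\<Union>t\<in>set ts. tm_vars t)"

primrec free_vars :: "fm \<Rightarrow> nat set" where
  "free_vars (Eq s t) = tm_vars s \<union> tm_vars t"
| "free_vars (Le s t) = tm_vars s \<union> tm_vars t"
| "free_vars (Rel r ts) = (\<Union>t\<in>set ts. tm_vars t)"
| "free_vars (Neg \<phi>) = free_vars \<phi>"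
| "free_vars (Con \<phi> \<psi>) = free_vars \<phi> \<union> free_vars \<psi>"
| "free_vars (Dis \<phi> \<psi>) = free_vars \<phi> \<union> free_vars \<psi>"
| "free_vars (Imp \<phi> \<psi>) = free_vars \<phi> \<union> free_vars \<psi>"
| "free_vars (BAll t \<phi>) = tm_vars t \<union> {n. Suc n \<in> free_vars \<phi>}"
| "free_vars (BEx t \<phi>) = tm_vars t \<union> {n. Suc n \<in> free_vars \<phi>}"
| "free_vars (All \<phi>) = {n. Suc n \<in> free_vars \<phi>}"
| "free_vars (Ex \<phi>) = {n. Suc n \<in> free_vars \<phi>}"

fun tm_subst :: "(nat \<Rightarrow> tm) \<Rightarrow> tm \<Rightarrow> tm" where
  "tm_subst \<sigma> (Var n) = \<sigma> n"
| "tm_subst \<sigma> (Fn f ts) = Fn f (map (tm_subst \<sigma>) ts)"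

text \<open>The substitution used below a quantifier.\<close>

definition up :: "(nat \<Rightarrow> tm) \<Rightarrow> nat \<Rightarrow> tm" where
  "up \<sigma> = case_nat (Var 0) (\<lambda>n. tm_subst (\<lambda>m. Var (Suc m)) (\<sigma> n))"

text \<open>Simultaneous capture-avoiding substitution of \<open>\<sigma> n\<close> for each free variable \<open>n\<close>.\<close>

primrec fm_subst :: "(nat \<Rightarrow> tm) \<Rightarrow> fm \<Rightarrow> fm" where
  "fm_subst \<sigma> (Eq s t) = Eq (tm_subst \<sigma> s) (tm_subst \<sigma> t)"
| "fm_subst \<sigma> (Le s t) = Le (tm_subst \<sigma> s) (tm_subst \<sigma> t)"
| "fm_subst \<sigma> (Rel r ts) = Rel r (map (tm_subst \<sigma>) ts)"
| "fm_subst \<sigma> (Neg \<phi>) = Neg (fm_subst \<sigma> \<phi>)"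
| "fm_subst \<sigma> (Con \<phi> \<psi>) = Con (fm_subst \<sigma> \<phi>) (fm_subst \<sigma> \<psi>)"
| "fm_subst \<sigma> (Dis \<phi> \<psi>) = Dis (fm_subst \<sigma> \<phi>) (fm_subst \<sigma> \<psi>)"
| "fm_subst \<sigma> (Imp \<phi> \<psi>) = Imp (fm_subst \<sigma> \<phi>) (fm_subst \<sigma> \<psi>)"
| "fm_subst \<sigma> (BAll t \<phi>) = BAll (tm_subst \<sigma> t) (fm_subst (up \<sigma>) \<phi>)"
| "fm_subst \<sigma> (BEx t \<phi>) = BEx (tm_subst \<sigma> t) (fm_subst (up \<sigma>) \<phi>)"
| "fm_subst \<sigma> (All \<phi>) = All (fm_subst (up \<sigma>) \<phi>)"
| "fm_subst \<sigma> (Ex \<phi>) = Ex (fm_subst (up \<sigma>) \<phi>)"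

primrec fully_bounded :: "fm \<Rightarrow> bool" where
  "fully_bounded (Eq s t) = True"
| "fully_bounded (Le s t) = True"
| "fully_bounded (Rel r ts) = True"
| "fully_bounded (Neg \<phi>) = fully_bounded \<phi>"
| "fully_bounded (Con \<phi> \<psi>) = (fully_bounded \<phi> \<and> fully_bounded \<psi>)"
| "fully_bounded (Dis \<phi> \<psi>) = (fully_bounded \<phi> \<and> fully_bounded \<psi>)"
| "fully_bounded (Imp \<phi> \<psi>) = (fully_bounded \<phi> \<and> fully_bounded \<psi>)"
| "fully_bounded (BAll t \<phi>) = fully_bounded \<phi>"
| "fully_bounded (BEx t \<phi>) = fully_bounded \<phi>"
| "fully_bounded (All \<phi>) = False"
| "fully_bounded (Ex \<phi>) = False"

text \<open>The negation of a prenex formula, again in prenex form: it exchanges the unbounded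
  quantifiers of the prefix and puts a negation sign in front of the matrix, so that it takes
  \<open>\<Pi>\<close> formulas of level \<open>k\<close> to \<open>\<Sigma>\<close> formulas of level \<open>k\<close>.\<close>

fun prenex_neg :: "fm \<Rightarrow> fm" where
  "prenex_neg (All \<phi>) = Ex (prenex_neg \<phi>)"
| "prenex_neg (Ex \<phi>) = All (prenex_neg \<phi>)"
| "prenex_neg \<phi> = Neg \<phi>"

text \<open>A fixed effective numbering of formulas. It serves only to say which sets of formulas are
  recursively enumerable, a notion that is the same for all effective numberings.\<close>

fun tm_number :: "tm \<Rightarrow> nat" where
  "tm_number (Var n) = prod_encode (0, n)"
| "tm_number (Fn f ts) = prod_encode (1, prod_encode (f, list_encode (map tm_number ts)))"

primrec fm_number :: "fm \<Rightarrow> nat" where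
  "fm_number (Eq s t) = prod_encode (0, prod_encode (tm_number s, tm_number t))"
| "fm_number (Le s t) = prod_encode (1, prod_encode (tm_number s, tm_number t))"
| "fm_number (Rel r ts) = prod_encode (2, prod_encode (r, list_encode (map tm_number ts)))"
| "fm_number (Neg \<phi>) = prod_encode (3, fm_number \<phi>)"
| "fm_number (Con \<phi> \<psi>) = prod_encode (4, prod_encode (fm_number \<phi>, fm_number \<psi>))"
| "fm_number (Dis \<phi> \<psi>) = prod_encode (5, prod_encode (fm_number \<phi>, fm_number \<psi>))"
| "fm_number (Imp \<phi> \<psi>) = prod_encode (6, prod_encode (fm_number \<phi>, fm_number \<psi>))"
| "fm_number (BAll t \<phi>) = prod_encode (7, prod_encode (tm_number t, fm_number \<phi>))"
| "fm_number (BEx t \<phi>) = prod_encode (8, prod_encode (tm_number t, fm_number \<phi>))"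
| "fm_number (All \<phi>) = prod_encode (9, fm_number \<phi>)"
| "fm_number (Ex \<phi>) = prod_encode (10, fm_number \<phi>)"

definition re_fms :: "fm set \<Rightarrow> bool" where
  "re_fms \<theta> \<longleftrightarrow> re_set (fm_number ` \<theta>)"


section \<open>Generic configurations\<close>

text \<open>A language comes with its symbols (paired with their arities), with their meaning in
  Standard-M, and with a term \<open>numeral_tm k\<close> of value \<open>k\<close> for each \<open>k\<close>. Equality and \<open>\<le>\<close> are
  built into the formulas; \<open>rsyms\<close> are additional relation symbols, possibly none.\<close>

record language =
  fsyms :: "(nat \<times> nat) set"
  rsyms :: "(nat \<times> nat) set"
  fmeaning :: "nat \<Rightarrow> nat list \<Rightarrow> nat"
  rmeaning :: "nat \<Rightarrow> nat list \<Rightarrow> bool"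
  numeral_tm :: "nat \<Rightarrow> tm"

record 'pf encoding =
  fm_code :: "fm \<Rightarrow> nat"
  pf_code :: "'pf \<Rightarrow> nat"

text \<open>\<open>ded \<xi> \<alpha> \<pi> \<phi>\<close>: the object \<open>\<pi>\<close> is a proof of \<open>\<phi>\<close> from the axiom system \<open>\<alpha>\<close>.\<close>

record 'pf config =
  lang :: language
  Delta0 :: "fm set"
  base :: "fm set"
  ded :: "fm set \<Rightarrow> 'pf \<Rightarrow> fm \<Rightarrow> bool"
  enc :: "'pf encoding"

fun is_tm :: "language \<Rightarrow> tm \<Rightarrow> bool" where
  "is_tm L (Var n) \<longleftrightarrow> True"
| "is_tm L (Fn f ts) \<longleftrightarrow> (f, length ts) \<in> fsyms L \<and> (\<forall>t\<in>set ts. is_tm L t)"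

primrec is_fm :: "language \<Rightarrow> fm \<Rightarrow> bool" where
  "is_fm L (Eq s t) \<longleftrightarrow> is_tm L s \<and> is_tm L t"
| "is_fm L (Le s t) \<longleftrightarrow> is_tm L s \<and> is_tm L t"
| "is_fm L (Rel r ts) \<longleftrightarrow> (r, length ts) \<in> rsyms L \<and> (\<forall>t\<in>set ts. is_tm L t)"
| "is_fm L (Neg \<phi>) \<longleftrightarrow> is_fm L \<phi>"
| "is_fm L (Con \<phi> \<psi>) \<longleftrightarrow> is_fm L \<phi> \<and> is_fm L \<psi>"
| "is_fm L (Dis \<phi> \<psi>) \<longleftrightarrow> is_fm L \<phi> \<and> is_fm L \<psi>"
| "is_fm L (Imp \<phi> \<psi>) \<longleftrightarrow> is_fm L \<phi> \<and> is_fm L \<psi>"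
| "is_fm L (BAll t \<phi>) \<longleftrightarrow> is_tm L t \<and> is_fm L \<phi>"
| "is_fm L (BEx t \<phi>) \<longleftrightarrow> is_tm L t \<and> is_fm L \<phi>"
| "is_fm L (All \<phi>) \<longleftrightarrow> is_fm L \<phi>"
| "is_fm L (Ex \<phi>) \<longleftrightarrow> is_fm L \<phi>"

definition sentences :: "language \<Rightarrow> fm set" where
  "sentences L = {\<phi>. is_fm L \<phi> \<and> free_vars \<phi> = {}}"

fun tm_val :: "language \<Rightarrow> (nat \<Rightarrow> nat) \<Rightarrow> tm \<Rightarrow> nat" where
  "tm_val L e (Var n) = e n"
| "tm_val L e (Fn f ts) = fmeaning L f (map (tm_val L e) ts)"

primrec sat :: "language \<Rightarrow> (nat \<Rightarrow> nat) \<Rightarrow> fm \<Rightarrow> bool" where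
  "sat L e (Eq s t) \<longleftrightarrow> tm_val L e s = tm_val L e t"
| "sat L e (Le s t) \<longleftrightarrow> tm_val L e s \<le> tm_val L e t"
| "sat L e (Rel r ts) \<longleftrightarrow> rmeaning L r (map (tm_val L e) ts)"
| "sat L e (Neg \<phi>) \<longleftrightarrow> \<not> sat L e \<phi>"
| "sat L e (Con \<phi> \<psi>) \<longleftrightarrow> sat L e \<phi> \<and> sat L e \<psi>"
| "sat L e (Dis \<phi> \<psi>) \<longleftrightarrow> sat L e \<phi> \<or> sat L e \<psi>"
| "sat L e (Imp \<phi> \<psi>) \<longleftrightarrow> (sat L e \<phi> \<longrightarrow> sat L e \<psi>)"
| "sat L e (BAll t \<phi>) \<longleftrightarrow> (\<forall>v\<le>tm_val L e t. sat L (case_nat v e) \<phi>)"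
| "sat L e (BEx t \<phi>) \<longleftrightarrow> (\<exists>v\<le>tm_val L e t. sat L (case_nat v e) \<phi>)"
| "sat L e (All \<phi>) \<longleftrightarrow> (\<forall>v. sat L (case_nat v e) \<phi>)"
| "sat L e (Ex \<phi>) \<longleftrightarrow> (\<exists>v. sat L (case_nat v e) \<phi>)"

text \<open>Truth in Standard-M. It is applied to sentences only, so the assignment does not matter.\<close>

definition true_in_M :: "language \<Rightarrow> fm \<Rightarrow> bool" where
  "true_in_M L \<phi> \<longleftrightarrow> sat L (\<lambda>_. 0) \<phi>"

definition generic_language :: "language \<Rightarrow> bool" where
  "generic_language L \<longleftrightarrow>
     (\<forall>i\<in>{0, 1, 2}. \<exists>c. (c, 0) \<in> fsyms L \<and> fmeaning L c [] = i) \<and>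
     (\<exists>m. (m, 2) \<in> fsyms L \<and> (\<forall>x y. fmeaning L m [x, y] = max x y)) \<and>
     (\<forall>k. is_tm L (numeral_tm L k) \<and> tm_vars (numeral_tm L k) = {} \<and>
          (\<forall>e. tm_val L e (numeral_tm L k) = k))"

fun is_Pi :: "'pf config \<Rightarrow> nat \<Rightarrow> fm \<Rightarrow> bool"
and is_Sigma :: "'pf config \<Rightarrow> nat \<Rightarrow> fm \<Rightarrow> bool" where
  "is_Pi \<xi> 0 \<phi> \<longleftrightarrow> \<phi> \<in> Delta0 \<xi>"
| "is_Pi \<xi> (Suc n) \<phi> \<longleftrightarrow> (\<exists>k \<Phi>. \<phi> = (All ^^ k) \<Phi> \<and> is_Sigma \<xi> n \<Phi>)"
| "is_Sigma \<xi> 0 \<phi> \<longleftrightarrow> \<phi> \<in> Delta0 \<xi>"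
| "is_Sigma \<xi> (Suc n) \<phi> \<longleftrightarrow> (\<exists>k \<Phi>. \<phi> = (Ex ^^ k) \<Phi> \<and> is_Pi \<xi> n \<Phi>)"

definition Pi_sentences :: "'pf config \<Rightarrow> nat \<Rightarrow> fm set" where
  "Pi_sentences \<xi> n = {\<phi> \<in> sentences (lang \<xi>). is_Pi \<xi> n \<phi>}"

definition Sigma_sentences :: "'pf config \<Rightarrow> nat \<Rightarrow> fm set" where
  "Sigma_sentences \<xi> n = {\<phi> \<in> sentences (lang \<xi>). is_Sigma \<xi> n \<phi>}"

definition Delta0_sentences :: "'pf config \<Rightarrow> fm set" where
  "Delta0_sentences \<xi> = sentences (lang \<xi>) \<inter> Delta0 \<xi>"

definition generic_Delta0 :: "'pf config \<Rightarrow> bool" where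
  "generic_Delta0 \<xi> \<longleftrightarrow>
     (\<forall>\<phi>\<in>Delta0 \<xi>. is_fm (lang \<xi>) \<phi> \<and> fully_bounded \<phi> \<and> Neg \<phi> \<in> Delta0 \<xi>) \<and>
     (\<exists>add\<in>Delta0 \<xi>. free_vars add \<subseteq> {0, 1, 2} \<and>
        (\<forall>e. sat (lang \<xi>) e add \<longleftrightarrow> e 0 + e 1 = e 2)) \<and>
     (\<exists>mult\<in>Delta0 \<xi>. free_vars mult \<subseteq> {0, 1, 2} \<and>
        (\<forall>e. sat (lang \<xi>) e mult \<longleftrightarrow> e 0 * e 1 = e 2))"

definition provable :: "'pf config \<Rightarrow> fm set \<Rightarrow> fm \<Rightarrow> bool" where
  "provable \<xi> \<alpha> \<phi> \<longleftrightarrow> (\<exists>\<pi>. ded \<xi> \<alpha> \<pi> \<phi>)"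

text \<open>Proofs identified with their Goedel numbers.\<close>

definition proves :: "'pf config \<Rightarrow> fm set \<Rightarrow> nat \<Rightarrow> fm \<Rightarrow> bool" where
  "proves \<xi> \<alpha> p \<phi> \<longleftrightarrow> (\<exists>\<pi>. ded \<xi> \<alpha> \<pi> \<phi> \<and> pf_code (enc \<xi>) \<pi> = p)"

definition generic_base :: "'pf config \<Rightarrow> bool" where
  "generic_base \<xi> \<longleftrightarrow>
     base \<xi> \<subseteq> sentences (lang \<xi>) \<and>
     (\<forall>\<phi>\<in>base \<xi>. true_in_M (lang \<xi>) \<phi>) \<and>
     (\<forall>\<phi>\<in>Sigma_sentences \<xi> 1. true_in_M (lang \<xi>) \<phi> \<longrightarrow> provable \<xi> (base \<xi>) \<phi>) \<and>
     (\<forall>\<phi>\<in>Pi_sentences \<xi> 1. \<not> true_in_M (lang \<xi>) \<phi> \<longrightarrow> provable \<xi> (base \<xi>) (Neg \<phi>))"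

text \<open>The first clause is soundness, which is part of being a deduction method; only its instance
  at Standard-M is demanded. The second clause is the indirect-implication property.\<close>

definition deduction_method :: "'pf config \<Rightarrow> bool" where
  "deduction_method \<xi> \<longleftrightarrow>
     (\<forall>\<alpha> \<phi>. \<alpha> \<subseteq> sentences (lang \<xi>) \<longrightarrow> \<phi> \<in> sentences (lang \<xi>) \<longrightarrow>
        (\<forall>\<psi>\<in>\<alpha>. true_in_M (lang \<xi>) \<psi>) \<longrightarrow> provable \<xi> \<alpha> \<phi> \<longrightarrow> true_in_M (lang \<xi>) \<phi>) \<and>
     (\<forall>\<alpha> X Y Z. \<alpha> \<subseteq> sentences (lang \<xi>) \<longrightarrow> {X, Y, Z} \<subseteq> sentences (lang \<xi>) \<longrightarrow>
        provable \<xi> \<alpha> X \<longrightarrow> provable \<xi> \<alpha> Y \<longrightarrow> provable \<xi> \<alpha> (Imp (Con X Y) Z) \<longrightarrow>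
        provable \<xi> \<alpha> Z)"

text \<open>Goedel numbers of proofs are positive since their logarithms are taken.\<close>

definition generic_encoding :: "'pf config \<Rightarrow> bool" where
  "generic_encoding \<xi> \<longleftrightarrow>
     inj_on (fm_code (enc \<xi>)) {\<phi>. is_fm (lang \<xi>) \<phi>} \<and>
     inj (pf_code (enc \<xi>)) \<and> (\<forall>\<pi>. 0 < pf_code (enc \<xi>) \<pi>)"

definition generic_configuration :: "'pf config \<Rightarrow> bool" where
  "generic_configuration \<xi> \<longleftrightarrow>
     generic_language (lang \<xi>) \<and> generic_Delta0 \<xi> \<and> generic_base \<xi> \<and>
     deduction_method \<xi> \<and> generic_encoding \<xi>"


section \<open>Goodness\<close>

text \<open>For a natural number \<open>v\<close> and a real \<open>N\<close>, possibly a proper fraction or negative, \<open>v\<close> is below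
  \<open>2 powr N\<close> iff it is below the ceiling of \<open>2 powr N\<close>; so the latter is the value of \<open>E(N)\<close>.\<close>

definition E_term :: "language \<Rightarrow> real \<Rightarrow> tm" where
  "E_term L N = numeral_tm L (nat \<lceil>2 powr N\<rceil>)"

text \<open>The strict bound \<open>v < T\<close> is expressed as \<open>v \<le> T\<close> and \<open>v \<noteq> T\<close>. The term \<open>T\<close> is closed.\<close>

fun bound_prefix :: "tm \<Rightarrow> fm \<Rightarrow> fm" where
  "bound_prefix T (All \<phi>) = BAll T (Imp (Neg (Eq (Var 0) T)) (bound_prefix T \<phi>))"
| "bound_prefix T (Ex \<phi>) = BEx T (Con (Neg (Eq (Var 0) T)) (bound_prefix T \<phi>))"
| "bound_prefix T \<phi> = \<phi>"

definition Scope_E :: "language \<Rightarrow> fm \<Rightarrow> real \<Rightarrow> fm" where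
  "Scope_E L \<Upsilon> N = bound_prefix (E_term L N) \<Upsilon>"

text \<open>The value at \<open>-\<infinity>\<close> is never used.\<close>

definition Good :: "language \<Rightarrow> ereal \<Rightarrow> fm \<Rightarrow> bool" where
  "Good L N \<Upsilon> \<longleftrightarrow>
     (if N = \<infinity> then true_in_M L \<Upsilon> else true_in_M L (Scope_E L \<Upsilon> (real_of_ereal N)))"

text \<open>For \<open>\<Pi>\<close> sentences of level 1 the integers \<open>J\<close> in question form an initial segment, so the
  supremum is their largest element or \<open>\<infinity>\<close>. It is \<open>-\<infinity>\<close> if there is no such \<open>J\<close>; then no \<open>p\<close>
  satisfies the bound on \<open>Log(p)\<close> in the stability notions.\<close>

definition sharp :: "language \<Rightarrow> fm set \<Rightarrow> ereal" where
  "sharp L \<theta> = Sup {ereal (real_of_int J) | J. \<forall>\<phi>\<in>\<theta>. Good L (ereal (real_of_int J)) \<phi>}"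


section \<open>Stability\<close>

definition RE_class :: "'pf config \<Rightarrow> fm set set" where
  "RE_class \<xi> = {\<theta>. \<theta> \<subseteq> Pi_sentences \<xi> 1 \<and> re_fms \<theta>}"

definition A_stable :: "'pf config \<Rightarrow> bool" where
  "A_stable \<xi> \<longleftrightarrow>
     (\<forall>\<theta>\<in>RE_class \<xi>. \<forall>\<Upsilon>\<in>Pi_sentences \<xi> 1. \<forall>p.
        proves \<xi> (\<theta> \<union> base \<xi>) p \<Upsilon> \<and> ereal (log 2 (real p)) \<le> sharp (lang \<xi>) \<theta> + 1 \<longrightarrow>
        Good (lang \<xi>) (sharp (lang \<xi>) \<theta> / 2) \<Upsilon>)"

definition E_stable :: "'pf config \<Rightarrow> bool" where
  "E_stable \<xi> \<longleftrightarrow>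
     (\<forall>\<theta>\<in>RE_class \<xi>. \<forall>\<Upsilon>\<in>Sigma_sentences \<xi> 1. \<forall>p.
        proves \<xi> (\<theta> \<union> base \<xi>) p \<Upsilon> \<and> ereal (log 2 (real p)) \<le> sharp (lang \<xi>) \<theta> + 1 \<longrightarrow>
        Good (lang \<xi>) (ereal (real_of_int \<lfloor>log 2 (real p)\<rfloor> / 2 - 1)) \<Upsilon>)"

definition EA_stable :: "'pf config \<Rightarrow> bool" where
  "EA_stable \<xi> \<longleftrightarrow> E_stable \<xi> \<and> A_stable \<xi>"

definition zero_stable :: "'pf config \<Rightarrow> bool" where
  "zero_stable \<xi> \<longleftrightarrow>
     (\<forall>\<theta>\<in>RE_class \<xi>. \<forall>\<Upsilon>\<in>Delta0_sentences \<xi>. \<forall>p.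
        proves \<xi> (\<theta> \<union> base \<xi>) p \<Upsilon> \<and> ereal (log 2 (real p)) \<le> sharp (lang \<xi>) \<theta> + 1 \<longrightarrow>
        true_in_M (lang \<xi>) \<Upsilon>)"


section \<open>Self-consistency axioms\<close>

definition neg_rel :: "'pf config \<Rightarrow> nat \<Rightarrow> nat \<Rightarrow> nat \<Rightarrow> bool" where
  "neg_rel \<xi> k x y \<longleftrightarrow>
     (\<exists>X\<in>Pi_sentences \<xi> k. x = fm_code (enc \<xi>) X \<and> y = fm_code (enc \<xi>) (prenex_neg X))"

definition subst_prf_rel :: "'pf config \<Rightarrow> fm set \<Rightarrow> nat \<Rightarrow> nat \<Rightarrow> nat \<Rightarrow> bool" where
  "subst_prf_rel \<xi> \<beta> g t p \<longleftrightarrow>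
     (\<exists>h \<Phi> H X. is_fm (lang \<xi>) \<Phi> \<and> g = fm_code (enc \<xi>) \<Phi> \<and>
        H = fm_subst (\<lambda>_. numeral_tm (lang \<xi>) g) \<Phi> \<and> h = fm_code (enc \<xi>) H \<and>
        X \<in> sentences (lang \<xi>) \<and> t = fm_code (enc \<xi>) X \<and> proves \<xi> (\<beta> \<union> {H}) p X)"

definition is_Neg_formula :: "'pf config \<Rightarrow> nat \<Rightarrow> fm \<Rightarrow> bool" where
  "is_Neg_formula \<xi> k \<nu> \<longleftrightarrow> \<nu> \<in> Delta0 \<xi> \<and> free_vars \<nu> \<subseteq> {0, 1} \<and>
     (\<forall>e. sat (lang \<xi>) e \<nu> \<longleftrightarrow> neg_rel \<xi> k (e 0) (e 1))"

definition is_SubstPrf_formula :: "'pf config \<Rightarrow> fm set \<Rightarrow> fm \<Rightarrow> bool" where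
  "is_SubstPrf_formula \<xi> \<beta> \<pi> \<longleftrightarrow> \<pi> \<in> Delta0 \<xi> \<and> free_vars \<pi> \<subseteq> {0, 1, 2} \<and>
     (\<forall>e. sat (lang \<xi>) e \<pi> \<longleftrightarrow> subst_prf_rel \<xi> \<beta> (e 0) (e 1) (e 2))"

definition app_vars :: "fm \<Rightarrow> nat list \<Rightarrow> fm" where
  "app_vars \<phi> vs = fm_subst (\<lambda>n. if n < length vs then Var (vs ! n) else Var n) \<phi>"

text \<open>Below the quantifiers for x, y, p, q (in this order), the de Bruijn indices of q, p, y, x
  are 0, 1, 2, 3, and the free variable g has index 4.\<close>

definition Gamma :: "fm \<Rightarrow> fm \<Rightarrow> fm" where
  "Gamma \<nu> \<pi> = All (All (All (All
     (Neg (Con (app_vars \<nu> [3, 2]) (Con (app_vars \<pi> [4, 3, 1]) (app_vars \<pi> [4, 2, 0])))))))"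

definition SelfCons :: "'pf config \<Rightarrow> fm \<Rightarrow> fm \<Rightarrow> fm" where
  "SelfCons \<xi> \<nu> \<pi> =
     fm_subst (\<lambda>_. numeral_tm (lang \<xi>) (fm_code (enc \<xi>) (Gamma \<nu> \<pi>))) (Gamma \<nu> \<pi>)"

text \<open>The formulas \<open>\<nu>\<close> and \<open>\<pi>\<close> for \<open>Neg\<close> and \<open>SubstPrf\<close> may be chosen freely, as long as the
  resulting axiom is a \<open>\<Pi>\<close> sentence of level 1. (This is not automatic, as the class \<open>Delta0\<close>
  need not be closed under conjunction and substitution.)\<close>

definition is_SelfCons :: "'pf config \<Rightarrow> nat \<Rightarrow> fm set \<Rightarrow> fm \<Rightarrow> bool" where
  "is_SelfCons \<xi> k \<beta> S \<longleftrightarrow> S \<in> Pi_sentences \<xi> 1 \<and>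
     (\<exists>\<nu> \<pi>. is_Neg_formula \<xi> k \<nu> \<and> is_SubstPrf_formula \<xi> \<beta> \<pi> \<and> S = SelfCons \<xi> \<nu> \<pi>)"

text \<open>The value of the function \<open>G\<close> at \<open>\<theta>\<close>, with \<open>S\<close> the self-consistency axiom of \<open>\<theta> \<union> base \<xi>\<close>.\<close>

definition G_ext :: "'pf config \<Rightarrow> fm \<Rightarrow> fm set \<Rightarrow> fm set" where
  "G_ext \<xi> S \<theta> = \<theta> \<union> base \<xi> \<union> {S}"

definition consistent :: "'pf config \<Rightarrow> fm set \<Rightarrow> bool" where
  "consistent \<xi> \<alpha> \<longleftrightarrow>
     \<not> (\<exists>X\<in>sentences (lang \<xi>). provable \<xi> \<alpha> X \<and> provable \<xi> \<alpha> (Neg X))"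

definition consistency_preserving :: "'pf config \<Rightarrow> nat \<Rightarrow> bool" where
  "consistency_preserving \<xi> k \<longleftrightarrow>
     (\<forall>\<theta>\<in>RE_class \<xi>. \<forall>S. is_SelfCons \<xi> k (\<theta> \<union> base \<xi>) S \<longrightarrow>
        (\<forall>\<phi>\<in>\<theta>. true_in_M (lang \<xi>) \<phi>) \<longrightarrow> consistent \<xi> (G_ext \<xi> S \<theta>))"

end

theory Submission
  imports Defs
begin

text \<open>If the self-consistency axiom \<open>S\<close> is true, soundness gives consistency. Otherwise take a
  counterexample \<open>(x, y, p, q)\<close> to \<open>S\<close> whose maximum \<open>m\<close> is least. By minimality \<open>S\<close> is
  \<open>Good(J)\<close> for \<open>J = \<lfloor>Log m\<rfloor>\<close>, and true \<open>\<Pi>\<^sub>1\<close> sentences are good everywhere, so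
  \<open>\<sharp>(\<theta> \<union> {S}) \<ge> J\<close>. Since \<open>p, q \<le> m\<close>, both proofs are short enough for stability to apply to
  \<open>\<theta> \<union> {S}\<close>; it makes a sentence and its negation good at comparable levels, which is
  impossible.\<close>

section \<open>Recursively enumerable sets\<close>

inductive_cases rec_eval_SuccE: "rec_eval Succ xs y"
inductive_cases rec_eval_ProjE: "rec_eval (Proj i) xs y"
inductive_cases rec_eval_CnE: "rec_eval (Cn f gs) xs y"
inductive_cases rec_eval_Pr0E: "rec_eval (Pr f g) (0 # xs) y"
inductive_cases rec_eval_PrSucE: "rec_eval (Pr f g) (Suc n # xs) y"

text \<open>Takes the value 0 only at \<open>a\<close>. In the second clause \<open>Pr\<close> acts
  as a case distinction: at 0 the value is 1, and at a successor its predecessor,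
  \<open>Proj 0\<close>, is tested against \<open>a\<close>.\<close>

primrec neq_test :: "nat \<Rightarrow> recf" where
  "neq_test 0 = Proj 0"
| "neq_test (Suc a) = Pr (Cn Succ [Zero]) (Cn (neq_test a) [Proj 0])"

lemma rec_eval_Proj: "i < length xs \<Longrightarrow> y = xs ! i \<Longrightarrow> rec_eval (Proj i) xs y"
  by (auto intro: rec_eval.intros)

lemma rec_eval_Cn1: "rec_eval g xs y \<Longrightarrow> rec_eval f [y] z \<Longrightarrow> rec_eval (Cn f [g]) xs z"
  by (auto intro!: rec_eval.intros(4)[where ys = "[y]"])

lemma rec_eval_Cn2:
  "rec_eval g xs y \<Longrightarrow> rec_eval h xs y' \<Longrightarrow> rec_eval f [y, y'] z \<Longrightarrow> rec_eval (Cn f [g, h]) xs z"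
  by (auto intro!: rec_eval.intros(4)[where ys = "[y, y']"])

lemma neq_test_total: "\<exists>y. rec_eval (neq_test a) [x] y"
proof (induction a arbitrary: x)
  case 0
  show ?case by (auto intro: rec_eval_Proj)
next
  case (Suc a)
  note IH = Suc.IH
  show ?case
  \<comment> \<open>A \<open>Pr\<close> code has a value at \<open>Suc x\<close> only if it has one
    at \<open>x\<close>, whatever the step does with that value; hence the inner induction.\<close>
  proof (induction x)
    case 0
    have "rec_eval (Cn Succ [Zero]) [] (Suc 0)"
      by (rule rec_eval_Cn1) (rule rec_eval.intros)+
    then show ?case by (auto intro: rec_eval.intros(5))
  next
    case (Suc x)
    then obtain r where r: "rec_eval (neq_test (Suc a)) [x] r" by blast
    obtain z where "rec_eval (neq_test a) [x] z" using IH by blast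
    then have "rec_eval (Cn (neq_test a) [Proj 0]) [x, r] z"
      by (auto intro: rec_eval_Cn1 rec_eval_Proj)
    then show ?case using r by (auto intro: rec_eval.intros(6))
  qed
qed

lemma neq_test_eq_0_iff: "rec_eval (neq_test a) [x] y \<Longrightarrow> y = 0 \<longleftrightarrow> x = a"
proof (induction a arbitrary: x y)
  case 0
  then show ?case by (auto elim: rec_eval_ProjE)
next
  case (Suc a)
  show ?case
  proof (cases x)
    case 0
    with Suc.prems show ?thesis
      by (auto elim!: rec_eval_Pr0E rec_eval_CnE rec_eval_SuccE)
  next
    case (Suc n)
    with Suc.prems have "rec_eval (neq_test a) [n] y"
      by (auto elim!: rec_eval_PrSucE rec_eval_CnE rec_eval_ProjE simp: list_all2_Cons1)
    with Suc.IH Suc show ?thesis by auto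
  qed
qed

text \<open>Primitive recursion serves as a lazy conditional: \<open>f\<close> is evaluated at \<open>x\<close> only if the test
  value is positive.\<close>

lemma re_set_insert:
  assumes "re_set A"
  shows "re_set (insert a A)"
proof -
  obtain f where f: "A = {x. \<exists>y. rec_eval f [x] y}"
    using assms by (auto simp: re_set_def)
  \<comment> \<open>The step receives \<open>n\<close>, the previous value and \<open>x\<close>, so
    \<open>Proj 2\<close> selects \<open>x\<close>.\<close>
  let ?g = "Pr Zero (Cn f [Proj 2])"
  let ?h = "Cn ?g [neq_test a, Proj 0]"
  have g_total: "\<exists>r. rec_eval ?g (n # [x]) r" if "n = 0 \<or> x \<in> A" for n x
    using that
  proof (induction n)
    case 0
    show ?case by (blast intro: rec_eval.intros)
  next
    case (Suc n)
    then obtain r z where "rec_eval ?g (n # [x]) r" "rec_eval f [x] z"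
      using f by auto
    moreover from this have "rec_eval (Cn f [Proj 2]) (n # r # [x]) z"
      by (intro rec_eval_Cn1[of "Proj 2" _ x]) (simp_all add: rec_eval_Proj)
    ultimately show ?case by (blast intro: rec_eval.intros(6))
  qed
  have "insert a A = {x. \<exists>y. rec_eval ?h [x] y}"
  proof (intro equalityI subsetI)
    fix x assume x: "x \<in> insert a A"
    obtain n where n: "rec_eval (neq_test a) [x] n"
      using neq_test_total by blast
    with x obtain r where "rec_eval ?g [n, x] r"
      using g_total neq_test_eq_0_iff by force
    with n have "rec_eval ?h [x] r"
      by (auto intro: rec_eval_Cn2 rec_eval_Proj)
    then show "x \<in> {x. \<exists>y. rec_eval ?h [x] y}" by blast
  next
    fix x assume "x \<in> {x. \<exists>y. rec_eval ?h [x] y}"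
    then obtain n y where n: "rec_eval (neq_test a) [x] n" and y: "rec_eval ?g [n, x] y"
      by (auto elim!: rec_eval_CnE rec_eval_ProjE simp: list_all2_Cons1)
    show "x \<in> insert a A"
    proof (cases n)
      case 0
      with n show ?thesis using neq_test_eq_0_iff by blast
    next
      case (Suc m)
      with y have "rec_eval f [x] y"
        by (auto elim!: rec_eval_PrSucE rec_eval_CnE rec_eval_ProjE simp: list_all2_Cons1)
      then show ?thesis using f by blast
    qed
  qed
  then show ?thesis unfolding re_set_def by blast
qed

text \<open>Stability speaks only of members of \<open>RE_class\<close>, and it will be applied to
  \<theta> enlarged by its own self-consistency axiom.\<close>

lemma RE_class_insert:
  "\<theta> \<in> RE_class \<xi> \<Longrightarrow> S \<in> Pi_sentences \<xi> 1 \<Longrightarrow> insert S \<theta> \<in> RE_class \<xi>"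
  by (auto simp: RE_class_def re_fms_def intro: re_set_insert)


section \<open>Substitution\<close>

lemma tm_val_subst: "tm_val L e (tm_subst \<sigma> t) = tm_val L (\<lambda>n. tm_val L e (\<sigma> n)) t"
  by (induction t) (auto intro: arg_cong[where f = "fmeaning L _"])

lemma tm_val_up:
  "(\<lambda>n. tm_val L (case_nat v e) (up \<sigma> n)) = case_nat v (\<lambda>n. tm_val L e (\<sigma> n))"
  by (rule ext) (auto simp: up_def tm_val_subst split: nat.split)

lemma sat_subst: "sat L e (fm_subst \<sigma> \<phi>) = sat L (\<lambda>n. tm_val L e (\<sigma> n)) \<phi>"
  by (induction \<phi> arbitrary: e \<sigma>) (simp_all add: tm_val_subst tm_val_up comp_def)

lemma is_tm_subst: "is_tm L t \<Longrightarrow> (\<And>n. is_tm L (\<sigma> n)) \<Longrightarrow> is_tm L (tm_subst \<sigma> t)"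
  by (induction t) auto

lemma is_tm_up: "(\<And>n. is_tm L (\<sigma> n)) \<Longrightarrow> is_tm L (up \<sigma> n)"
  by (auto simp: up_def split: nat.split intro: is_tm_subst)

lemma is_fm_subst: "is_fm L \<phi> \<Longrightarrow> (\<And>n. is_tm L (\<sigma> n)) \<Longrightarrow> is_fm L (fm_subst \<sigma> \<phi>)"
  by (induction \<phi> arbitrary: \<sigma>) (auto simp: is_tm_subst is_tm_up)


section \<open>Prenex negation and goodness\<close>

text \<open>\<open>prenex_neg\<close> and, in the next lemma, \<open>bound_prefix\<close> recurse
  only through leading \<open>All\<close> and \<open>Ex\<close>, which a fully bounded formula
  lacks.\<close>

lemma fully_bounded_prenex_neg: "fully_bounded \<phi> \<Longrightarrow> prenex_neg \<phi> = Neg \<phi>"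
  by (cases \<phi>) auto

lemma fully_bounded_bound_prefix: "fully_bounded \<phi> \<Longrightarrow> bound_prefix T \<phi> = \<phi>"
  by (cases \<phi>) auto

lemma prenex_neg_funpow_All: "prenex_neg ((All ^^ k) \<phi>) = (Ex ^^ k) (prenex_neg \<phi>)"
  by (induction k) auto

lemma is_fm_prenex_neg: "is_fm L (prenex_neg \<phi>) \<longleftrightarrow> is_fm L \<phi>"
  by (induction \<phi> rule: prenex_neg.induct) auto

lemma free_vars_prenex_neg: "free_vars (prenex_neg \<phi>) = free_vars \<phi>"
  by (induction \<phi> rule: prenex_neg.induct) auto

lemma sat_prenex_neg: "sat L e (prenex_neg \<phi>) \<longleftrightarrow> \<not> sat L e \<phi>"
  by (induction \<phi> arbitrary: e rule: prenex_neg.induct) auto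

text \<open>\<open>bound_prefix\<close> copies \<open>T\<close> under binders without shifting, so
  \<open>T\<close> is taken to have one value in all assignments. The guard excluding
  \<open>T\<close> itself makes the bound strict.\<close>

lemma sat_bound_prefix_All:
  "(\<And>e. tm_val L e T = t) \<Longrightarrow>
   sat L e (bound_prefix T (All \<phi>)) \<longleftrightarrow> (\<forall>v<t. sat L (case_nat v e) (bound_prefix T \<phi>))"
  by (auto simp: le_less)

text \<open>Duality survives bounding because the guard is joined by \<open>Imp\<close> under
  \<open>BAll\<close> and by \<open>Con\<close> under \<open>BEx\<close>.\<close>

lemma sat_bound_prefix_prenex_neg:
  "(\<And>e. tm_val L e T = t) \<Longrightarrow>
   sat L e (bound_prefix T (prenex_neg \<phi>)) \<longleftrightarrow> \<not> sat L e (bound_prefix T \<phi>)"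
  by (induction \<phi> arbitrary: e rule: prenex_neg.induct) auto

lemma sat_bound_prefix_antimono:
  assumes "fully_bounded \<phi>" "\<And>e. tm_val L e T = t" "\<And>e. tm_val L e T' = t'" "t \<le> t'"
  shows "sat L e (bound_prefix T' ((All ^^ k) \<phi>)) \<Longrightarrow> sat L e (bound_prefix T ((All ^^ k) \<phi>))"
proof (induction k arbitrary: e)
  case 0
  then show ?case using assms(1) by (simp add: fully_bounded_bound_prefix)
next
  case (Suc k)
  then show ?case using assms
    by (simp add: sat_bound_prefix_All del: bound_prefix.simps)
qed

lemma sat_imp_sat_bound_prefix:
  assumes "fully_bounded \<phi>" "\<And>e. tm_val L e T = t"
  shows "sat L e ((All ^^ k) \<phi>) \<Longrightarrow> sat L e (bound_prefix T ((All ^^ k) \<phi>))"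
proof (induction k arbitrary: e)
  case 0
  then show ?case using assms(1) by (simp add: fully_bounded_bound_prefix)
next
  case (Suc k)
  then show ?case using assms
    by (simp add: sat_bound_prefix_All del: bound_prefix.simps)
qed

section \<open>Goodness and quantifier classes in a generic configuration\<close>

context
  fixes \<xi> :: "'pf config"
  assumes conf: "generic_configuration \<xi>"
begin

lemma numeral_tm:
  "tm_val (lang \<xi>) e (numeral_tm (lang \<xi>) k) = k" "is_tm (lang \<xi>) (numeral_tm (lang \<xi>) k)"
  using conf by (auto simp: generic_configuration_def generic_language_def)

lemma tm_val_E_term: "tm_val (lang \<xi>) e (E_term (lang \<xi>) N) = nat \<lceil>2 powr N\<rceil>"
  by (simp add: E_term_def numeral_tm)

lemma Delta0D:
  "\<phi> \<in> Delta0 \<xi> \<Longrightarrow> is_fm (lang \<xi>) \<phi>"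
  "\<phi> \<in> Delta0 \<xi> \<Longrightarrow> fully_bounded \<phi>"
  "\<phi> \<in> Delta0 \<xi> \<Longrightarrow> Neg \<phi> \<in> Delta0 \<xi>"
  using conf by (auto simp: generic_configuration_def generic_Delta0_def)

lemma Pi_1E:
  assumes "\<phi> \<in> Pi_sentences \<xi> 1"
  obtains k \<Phi> where "\<phi> = (All ^^ k) \<Phi>" "\<Phi> \<in> Delta0 \<xi>" "fully_bounded \<Phi>"
  using assms Delta0D by (auto simp: Pi_sentences_def)

text \<open>Ensures that true axioms never lower \<open>sharp\<close>: restricting universal
  quantifiers preserves truth.\<close>

lemma Pi_1_Good:
  assumes "\<phi> \<in> Pi_sentences \<xi> 1" "true_in_M (lang \<xi>) \<phi>"
  shows "Good (lang \<xi>) N \<phi>"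
proof -
  obtain k \<Phi> where "\<phi> = (All ^^ k) \<Phi>" "fully_bounded \<Phi>"
    using assms(1) by (rule Pi_1E)
  then show ?thesis
    using assms(2) sat_imp_sat_bound_prefix[OF _ tm_val_E_term]
    by (auto simp: Good_def true_in_M_def Scope_E_def)
qed

lemma prenex_neg_Pi_1:
  assumes "\<phi> \<in> Pi_sentences \<xi> 1"
  shows "prenex_neg \<phi> \<in> Sigma_sentences \<xi> 1"
proof -
  obtain k \<Phi> where \<phi>: "\<phi> = (All ^^ k) \<Phi>" "\<Phi> \<in> Delta0 \<xi>" "fully_bounded \<Phi>"
    using assms by (rule Pi_1E)
  then have "prenex_neg \<phi> = (Ex ^^ k) (Neg \<Phi>)" "Neg \<Phi> \<in> Delta0 \<xi>"
    by (simp_all add: prenex_neg_funpow_All fully_bounded_prenex_neg Delta0D)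
  then have "is_Sigma \<xi> 1 (prenex_neg \<phi>)" by auto
  with assms show ?thesis
    by (simp add: Pi_sentences_def Sigma_sentences_def sentences_def
        is_fm_prenex_neg free_vars_prenex_neg)
qed

text \<open>Goodness of a universal sentence passes down from \<open>N\<close> to \<open>r\<close>,
  and at the common level \<open>r\<close> bounding commutes with negation. This is where A- and
  E-stability collide.\<close>

lemma not_Good_prenex_neg:
  assumes "\<phi> \<in> Pi_sentences \<xi> 1" "Good (lang \<xi>) N \<phi>" "ereal r \<le> N"
  shows "\<not> Good (lang \<xi>) (ereal r) (prenex_neg \<phi>)"
proof -
  obtain k \<Phi> where \<phi>: "\<phi> = (All ^^ k) \<Phi>" "fully_bounded \<Phi>"
    using assms(1) by (rule Pi_1E)
  have "Good (lang \<xi>) (ereal r) \<phi>"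
  proof (cases N)
    case (real s)
    with assms(3) have "nat \<lceil>2 powr r\<rceil> \<le> nat \<lceil>2 powr s\<rceil>"
      by (intro nat_mono ceiling_mono) auto
    then show ?thesis
      using assms(2) \<phi> sat_bound_prefix_antimono[OF _ tm_val_E_term tm_val_E_term] real
      by (auto simp: Good_def true_in_M_def Scope_E_def)
  next
    case PInf
    with assms(2) have "true_in_M (lang \<xi>) \<phi>" by (simp add: Good_def)
    with assms(1) show ?thesis by (rule Pi_1_Good)
  qed (use assms(3) in auto)
  then show ?thesis
    by (auto simp: Good_def true_in_M_def Scope_E_def
        sat_bound_prefix_prenex_neg[OF tm_val_E_term])
qed

lemma Delta0_Good_iff:
  "\<phi> \<in> Delta0 \<xi> \<Longrightarrow> Good (lang \<xi>) N \<phi> \<longleftrightarrow> true_in_M (lang \<xi>) \<phi>"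
  by (simp add: Good_def Scope_E_def fully_bounded_bound_prefix Delta0D)

lemma Delta0_sentence_levels:
  assumes "\<phi> \<in> Pi_sentences \<xi> 0"
  shows "\<phi> \<in> Delta0_sentences \<xi>" "\<phi> \<in> Pi_sentences \<xi> 1" "\<phi> \<in> Sigma_sentences \<xi> 1"
proof -
  have \<phi>: "\<phi> \<in> Delta0 \<xi>" "\<phi> \<in> sentences (lang \<xi>)"
    using assms by (auto simp: Pi_sentences_def)
  \<comment> \<open>The empty quantifier block places a \<open>Delta0\<close> sentence in both
    classes of level 1.\<close>
  moreover have "\<phi> = (All ^^ 0) \<phi>" "\<phi> = (Ex ^^ 0) \<phi>" by simp_all
  ultimately have "is_Pi \<xi> 1 \<phi>" "is_Sigma \<xi> 1 \<phi>"
    unfolding One_nat_def is_Pi.simps is_Sigma.simps by blast+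
  with \<phi> show "\<phi> \<in> Delta0_sentences \<xi>" "\<phi> \<in> Pi_sentences \<xi> 1" "\<phi> \<in> Sigma_sentences \<xi> 1"
    by (auto simp: Pi_sentences_def Sigma_sentences_def Delta0_sentences_def)
qed

lemma prenex_neg_Pi_0:
  assumes "\<phi> \<in> Pi_sentences \<xi> 0"
  shows "prenex_neg \<phi> \<in> Pi_sentences \<xi> 0"
  using assms by (auto simp: Pi_sentences_def sentences_def fully_bounded_prenex_neg Delta0D)


section \<open>The self-consistency axiom\<close>

text \<open>For \<open>g\<close> the code of \<open>Gamma\<close>, these tuples are the
  counterexamples to the self-consistency axiom.\<close>

definition refutes :: "nat \<Rightarrow> fm set \<Rightarrow> nat \<Rightarrow> nat \<Rightarrow> nat \<Rightarrow> nat \<Rightarrow> nat \<Rightarrow> bool" where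
  "refutes k \<beta> g x y p q \<longleftrightarrow>
     neg_rel \<xi> k x y \<and> subst_prf_rel \<xi> \<beta> g x p \<and> subst_prf_rel \<xi> \<beta> g y q"

context
  fixes k \<beta> \<nu> \<pi>
  assumes \<nu>: "is_Neg_formula \<xi> k \<nu>" and \<pi>: "is_SubstPrf_formula \<xi> \<beta> \<pi>"
begin

lemma is_fm_Gamma: "is_fm (lang \<xi>) (Gamma \<nu> \<pi>)"
  using \<nu> \<pi>
  by (auto simp: Gamma_def app_vars_def is_Neg_formula_def is_SubstPrf_formula_def Delta0D
      intro!: is_fm_subst)

text \<open>By \<open>sat_subst\<close> the numeral for the code of \<open>Gamma\<close> becomes the
  value of its free variable, which has index 4 below the four quantifiers. Indices are reduced to
  \<open>Suc\<close> form so that the \<open>case_nat\<close> assignments compute.\<close>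

lemma sat_SelfCons:
  "sat (lang \<xi>) e (SelfCons \<xi> \<nu> \<pi>) \<longleftrightarrow>
   (\<forall>x y p q. \<not> refutes k \<beta> (fm_code (enc \<xi>) (Gamma \<nu> \<pi>)) x y p q)"
  using \<nu> \<pi> unfolding SelfCons_def sat_subst Gamma_def app_vars_def
  by (simp add: sat_subst numeral_tm refutes_def is_Neg_formula_def is_SubstPrf_formula_def
      numeral_2_eq_2 numeral_3_eq_3 eval_nat_numeral)

text \<open>\<open>bound_prefix\<close> passes through the four outer quantifiers and stops at the
  \<open>Neg\<close> of the matrix, so it bounds each entry of a counterexample and nothing
  else.\<close>

lemma sat_Scope_E_SelfCons:
  "sat (lang \<xi>) e (Scope_E (lang \<xi>) (SelfCons \<xi> \<nu> \<pi>) N) \<longleftrightarrow>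
   (let b = nat \<lceil>2 powr N\<rceil> in
    \<forall>x<b. \<forall>y<b. \<forall>p<b. \<forall>q<b. \<not> refutes k \<beta> (fm_code (enc \<xi>) (Gamma \<nu> \<pi>)) x y p q)"
  using \<nu> \<pi> unfolding SelfCons_def Scope_E_def
  by (subst (1) Gamma_def)
     (simp add: sat_bound_prefix_All[OF tm_val_E_term] sat_subst tm_val_up app_vars_def Let_def
       numeral_tm refutes_def is_Neg_formula_def is_SubstPrf_formula_def eval_nat_numeral
       del: bound_prefix.simps(1,2))

text \<open>\<open>subst_prf_rel\<close> mentions merely some formula with code \<open>g\<close>.
  Injectivity of the coding identifies it with \<open>Gamma\<close>, and substituting the code of
  \<open>Gamma\<close> into it yields \<open>SelfCons\<close>: the axiom does speak of proofs from
  itself.\<close>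

lemma subst_prf_relD:
  assumes "subst_prf_rel \<xi> \<beta> (fm_code (enc \<xi>) (Gamma \<nu> \<pi>)) (fm_code (enc \<xi>) X) p"
    "is_fm (lang \<xi>) X"
  shows "proves \<xi> (\<beta> \<union> {SelfCons \<xi> \<nu> \<pi>}) p X"
proof -
  have inj: "inj_on (fm_code (enc \<xi>)) {\<phi>. is_fm (lang \<xi>) \<phi>}"
    using conf by (auto simp: generic_configuration_def generic_encoding_def)
  let ?g = "fm_code (enc \<xi>) (Gamma \<nu> \<pi>)"
  obtain \<Phi> X' where *: "is_fm (lang \<xi>) \<Phi>" "?g = fm_code (enc \<xi>) \<Phi>" "X' \<in> sentences (lang \<xi>)"
    "fm_code (enc \<xi>) X = fm_code (enc \<xi>) X'"
    "proves \<xi> (\<beta> \<union> {fm_subst (\<lambda>_. numeral_tm (lang \<xi>) ?g) \<Phi>}) p X'"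
    using assms(1) unfolding subst_prf_rel_def by blast
  have "Gamma \<nu> \<pi> = \<Phi>"
    using inj_onD[OF inj *(2)] *(1) is_fm_Gamma by blast
  moreover have "X = X'"
    using inj_onD[OF inj *(4)] *(3) assms(2) by (auto simp: sentences_def)
  ultimately show ?thesis using *(5) by (simp add: SelfCons_def)
qed

end

section \<open>From a least counterexample to consistency\<close>

lemma proves_pos: "proves \<xi> \<alpha> p \<phi> \<Longrightarrow> 0 < p"
  using conf by (auto simp: proves_def generic_configuration_def generic_encoding_def)

lemma false_SelfCons:
  assumes S: "is_SelfCons \<xi> k \<beta> S" "\<not> true_in_M (lang \<xi>) S"
  obtains X p q J where "X \<in> Pi_sentences \<xi> k"
    "proves \<xi> (\<beta> \<union> {S}) p X" "proves \<xi> (\<beta> \<union> {S}) q (prenex_neg X)"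
    "Good (lang \<xi>) (ereal (real_of_int J)) S"
    "log 2 (real p) < real_of_int J + 1" "log 2 (real q) < real_of_int J + 1"
proof -
  obtain \<nu> \<pi> where \<nu>: "is_Neg_formula \<xi> k \<nu>" and \<pi>: "is_SubstPrf_formula \<xi> \<beta> \<pi>"
    and S_eq: "S = SelfCons \<xi> \<nu> \<pi>"
    using S(1) by (auto simp: is_SelfCons_def)
  define R where "R = refutes k \<beta> (fm_code (enc \<xi>) (Gamma \<nu> \<pi>))"
  \<comment> \<open>\<open>P m\<close> bounds the maximum of some counterexample by
    \<open>m\<close>, so the least such \<open>m\<close> is the least possible maximum.\<close>
  define P where "P m \<longleftrightarrow> (\<exists>x\<le>m. \<exists>y\<le>m. \<exists>p\<le>m. \<exists>q\<le>m. R x y p q)" for m :: nat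
  obtain x y p q where "R x y p q"
    using S(2) sat_SelfCons[OF \<nu> \<pi>] by (auto simp: true_in_M_def S_eq R_def)
  then have "P (Max {x, y, p, q})"
    unfolding P_def by (intro exI[of _ x] exI[of _ y] exI[of _ p] exI[of _ q] conjI) auto
  then have "P (LEAST m. P m)" by (rule LeastI)
  moreover define m where "m = (LEAST m. P m)"
  ultimately obtain x y p q where le: "p \<le> m" "q \<le> m" and R: "R x y p q"
    unfolding P_def by blast
  obtain X where X: "X \<in> Pi_sentences \<xi> k" "x = fm_code (enc \<xi>) X"
    "y = fm_code (enc \<xi>) (prenex_neg X)"
    using R by (auto simp: R_def refutes_def neg_rel_def)
  then have fm: "is_fm (lang \<xi>) X" by (simp add: Pi_sentences_def sentences_def)
  have p: "proves \<xi> (\<beta> \<union> {S}) p X"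
    using R X fm unfolding S_eq
    by (intro subst_prf_relD[OF \<nu> \<pi>]) (simp_all add: R_def refutes_def)
  have q: "proves \<xi> (\<beta> \<union> {S}) q (prenex_neg X)"
    using R X fm unfolding S_eq
    by (intro subst_prf_relD[OF \<nu> \<pi>]) (simp_all add: R_def refutes_def is_fm_prenex_neg)
  have pos: "0 < p" "0 < q" "0 < m" using p q le proves_pos by fastforce+
  \<comment> \<open>\<open>2 powr J\<close> is the largest power of two not exceeding
    \<open>m\<close>, so entries below it are smaller than \<open>m\<close>.\<close>
  define J where "J = \<lfloor>log 2 (real m)\<rfloor>"
  have "2 powr J \<le> real m"
    using pos by (simp add: J_def powr_le_iff)
  then have "nat \<lceil>2 powr J\<rceil> \<le> m"
    by (simp add: ceiling_le_iff)
  have good: "Good (lang \<xi>) (ereal (real_of_int J)) S"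
  proof (rule ccontr)
    let ?b = "nat \<lceil>2 powr J\<rceil>"
    assume "\<not> ?thesis"
    then obtain x y p q where "x < ?b" "y < ?b" "p < ?b" "q < ?b" "R x y p q"
      using sat_Scope_E_SelfCons[OF \<nu> \<pi>]
      by (auto simp: Good_def true_in_M_def S_eq R_def Let_def)
    \<comment> \<open>The bound \<open>?b - 1\<close> is less than \<open>m\<close>, because
      \<open>x < ?b\<close> makes \<open>?b\<close> positive.\<close>
    moreover from this have "x \<le> ?b - 1" "y \<le> ?b - 1" "p \<le> ?b - 1" "q \<le> ?b - 1" by linarith+
    ultimately have "P (?b - 1)" unfolding P_def by blast
    then have "m \<le> ?b - 1" unfolding m_def by (rule Least_le)
    with \<open>x < ?b\<close> \<open>?b \<le> m\<close> show False by linarith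
  qed
  have "log 2 (real p) \<le> log 2 (real m)" "log 2 (real q) \<le> log 2 (real m)"
    using pos le by auto
  \<comment> \<open>Strictness matters: it will give \<lfloor>Log q\<rfloor> \<le> J.\<close>
  moreover have "log 2 (real m) < J + 1"
    unfolding J_def by linarith
  ultimately show ?thesis using that[OF X(1) p q good] by linarith
qed

text \<open>The \<theta> of the assumption will be the original set with \<open>S\<close> added. If
  \<open>S\<close> were false, \<open>false_SelfCons\<close> would supply contradictory proofs that
  are short relative to this enlarged set; the last bound controls the level that E-stability
  yields. Once \<open>S\<close> is true, soundness finishes.\<close>

lemma consistency_preservingI:
  assumes "\<And>\<theta> X p q J. \<theta> \<in> RE_class \<xi> \<Longrightarrow> X \<in> Pi_sentences \<xi> k \<Longrightarrow>
    proves \<xi> (\<theta> \<union> base \<xi>) p X \<Longrightarrow> proves \<xi> (\<theta> \<union> base \<xi>) q (prenex_neg X) \<Longrightarrow>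
    ereal (log 2 (real p)) \<le> sharp (lang \<xi>) \<theta> + 1 \<Longrightarrow>
    ereal (log 2 (real q)) \<le> sharp (lang \<xi>) \<theta> + 1 \<Longrightarrow>
    ereal (real_of_int \<lfloor>log 2 (real q)\<rfloor>) \<le> sharp (lang \<xi>) \<theta> \<Longrightarrow> False"
  shows "consistency_preserving \<xi> k"
  unfolding consistency_preserving_def
proof (intro ballI allI impI)
  fix \<theta> S
  assume \<theta>: "\<theta> \<in> RE_class \<xi>" and S: "is_SelfCons \<xi> k (\<theta> \<union> base \<xi>) S"
    and true: "\<forall>\<phi>\<in>\<theta>. true_in_M (lang \<xi>) \<phi>"
  have Pi: "S \<in> Pi_sentences \<xi> 1" "\<theta> \<subseteq> Pi_sentences \<xi> 1"
    using S \<theta> by (auto simp: is_SelfCons_def RE_class_def)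
  have "true_in_M (lang \<xi>) S"
  proof (rule ccontr)
    assume "\<not> ?thesis"
    with S obtain X p q J where *: "X \<in> Pi_sentences \<xi> k"
      "proves \<xi> (\<theta> \<union> base \<xi> \<union> {S}) p X" "proves \<xi> (\<theta> \<union> base \<xi> \<union> {S}) q (prenex_neg X)"
      "Good (lang \<xi>) (ereal (real_of_int J)) S"
      "log 2 (real p) < real_of_int J + 1" "log 2 (real q) < real_of_int J + 1"
      by (rule false_SelfCons)
    \<comment> \<open>Members of \<theta> are true and hence good at level \<open>J\<close>;
      \<open>S\<close> is good there by choice of \<open>J\<close>.\<close>
    have sharp: "ereal (real_of_int J) \<le> sharp (lang \<xi>) (insert S \<theta>)"
      unfolding sharp_def using *(4) Pi true Pi_1_Good by (intro Sup_upper) blast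
    have short: "ereal r \<le> sharp (lang \<xi>) (insert S \<theta>) + 1" if "r < real_of_int J + 1" for r
      using sharp that by (cases "sharp (lang \<xi>) (insert S \<theta>)") auto
    have "\<lfloor>log 2 (real q)\<rfloor> \<le> J" using *(6) by linarith
    then have floor: "ereal (real_of_int \<lfloor>log 2 (real q)\<rfloor>) \<le> sharp (lang \<xi>) (insert S \<theta>)"
      by (intro order_trans[OF _ sharp]) simp
    have eq: "\<theta> \<union> base \<xi> \<union> {S} = insert S \<theta> \<union> base \<xi>" by auto
    show False
      by (rule assms[OF RE_class_insert[OF \<theta> Pi(1)] *(1) *(2,3)[unfolded eq]
            short[OF *(5)] short[OF *(6)] floor])
  qed
  then have true_G: "\<forall>\<phi>\<in>G_ext \<xi> S \<theta>. true_in_M (lang \<xi>) \<phi>" "G_ext \<xi> S \<theta> \<subseteq> sentences (lang \<xi>)"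
    using true Pi conf
    by (auto simp: G_ext_def generic_configuration_def generic_base_def Pi_sentences_def)
  have sound: "true_in_M (lang \<xi>) \<phi>"
    if "provable \<xi> (G_ext \<xi> S \<theta>) \<phi>" "\<phi> \<in> sentences (lang \<xi>)" for \<phi>
  proof -
    have "\<forall>\<alpha> \<phi>. \<alpha> \<subseteq> sentences (lang \<xi>) \<longrightarrow> \<phi> \<in> sentences (lang \<xi>) \<longrightarrow>
        (\<forall>\<psi>\<in>\<alpha>. true_in_M (lang \<xi>) \<psi>) \<longrightarrow> provable \<xi> \<alpha> \<phi> \<longrightarrow> true_in_M (lang \<xi>) \<phi>"
      using conf unfolding generic_configuration_def deduction_method_def by (elim conjE)
    with true_G that show ?thesis by blast
  qed
  show "consistent \<xi> (G_ext \<xi> S \<theta>)"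
    unfolding consistent_def
  proof
    assume "\<exists>X\<in>sentences (lang \<xi>). provable \<xi> (G_ext \<xi> S \<theta>) X \<and> provable \<xi> (G_ext \<xi> S \<theta>) (Neg X)"
    then obtain X where "X \<in> sentences (lang \<xi>)" "true_in_M (lang \<xi>) X" "true_in_M (lang \<xi>) (Neg X)"
      using sound by (auto simp: sentences_def)
    then show False by (simp add: true_in_M_def)
  qed
qed

lemma EA_stable_consistency_preserving:
  assumes "EA_stable \<xi>"
  shows "consistency_preserving \<xi> 1"
proof (rule consistency_preservingI)
  fix \<theta> X p q
  assume \<theta>: "\<theta> \<in> RE_class \<xi>" and X: "X \<in> Pi_sentences \<xi> 1"
    and pf: "proves \<xi> (\<theta> \<union> base \<xi>) p X" "proves \<xi> (\<theta> \<union> base \<xi>) q (prenex_neg X)"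
    and le: "ereal (log 2 (real p)) \<le> sharp (lang \<xi>) \<theta> + 1"
      "ereal (log 2 (real q)) \<le> sharp (lang \<xi>) \<theta> + 1"
      "ereal (real_of_int \<lfloor>log 2 (real q)\<rfloor>) \<le> sharp (lang \<xi>) \<theta>"
  have "Good (lang \<xi>) (sharp (lang \<xi>) \<theta> / 2) X"
    using assms \<theta> X pf(1) le(1) unfolding EA_stable_def A_stable_def by blast
  moreover have "Good (lang \<xi>) (ereal (real_of_int \<lfloor>log 2 (real q)\<rfloor> / 2 - 1)) (prenex_neg X)"
    using assms \<theta> prenex_neg_Pi_1[OF X] pf(2) le(2)
    unfolding EA_stable_def E_stable_def by blast
  \<comment> \<open>The level from E-stability for the negation lies below the level from
    A-stability for \<open>X\<close>, as \<lfloor>Log q\<rfloor> is at most \<open>sharp\<close>; an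
    infinite \<open>sharp\<close> stays infinite when halved.\<close>
  moreover have "ereal (real_of_int \<lfloor>log 2 (real q)\<rfloor> / 2 - 1) \<le> sharp (lang \<xi>) \<theta> / 2"
    using le(3) by (cases "sharp (lang \<xi>) \<theta>") auto
  ultimately show False using not_Good_prenex_neg[OF X] by blast
qed

text \<open>At level 0 the negation is again in \<open>Delta0\<close>, so a single stability notion
  handles both proofs. For such sentences goodness at any level is truth, so A- and E-stability act
  as 0-stability does, and a sentence and its negation would both be true.\<close>

lemma stable_consistency_preserving_0:
  assumes "A_stable \<xi> \<or> E_stable \<xi> \<or> zero_stable \<xi>"
  shows "consistency_preserving \<xi> 0"
proof (rule consistency_preservingI)
  fix \<theta> X p q
  assume \<theta>: "\<theta> \<in> RE_class \<xi>" and X: "X \<in> Pi_sentences \<xi> 0"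
    and pf: "proves \<xi> (\<theta> \<union> base \<xi>) p X" "proves \<xi> (\<theta> \<union> base \<xi>) q (prenex_neg X)"
    and le: "ereal (log 2 (real p)) \<le> sharp (lang \<xi>) \<theta> + 1"
      "ereal (log 2 (real q)) \<le> sharp (lang \<xi>) \<theta> + 1"
  have "true_in_M (lang \<xi>) Y"
    if Y: "Y \<in> Pi_sentences \<xi> 0" "proves \<xi> (\<theta> \<union> base \<xi>) r Y"
      "ereal (log 2 (real r)) \<le> sharp (lang \<xi>) \<theta> + 1" for Y r
  proof -
    have "Y \<in> Delta0 \<xi>" using Y(1) by (simp add: Pi_sentences_def)
    then show ?thesis
      using assms \<theta> Y(2,3) Delta0_sentence_levels[OF Y(1)] Delta0_Good_iff
      unfolding A_stable_def E_stable_def zero_stable_def by blast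
  qed
  from this[OF X pf(1) le(1)] this[OF prenex_neg_Pi_0[OF X] pf(2) le(2)]
  show False by (simp add: true_in_M_def sat_prenex_neg)
qed

end

theorem theorem6p3:
  fixes \<xi> :: "'pf config"
  assumes "generic_configuration \<xi>"
  shows "(EA_stable \<xi> \<longrightarrow> consistency_preserving \<xi> 1) \<and>
         (A_stable \<xi> \<or> E_stable \<xi> \<or> zero_stable \<xi> \<longrightarrow> consistency_preserving \<xi> 0)"
  using EA_stable_consistency_preserving[OF assms] stable_consistency_preserving_0[OF assms]
  by blast

end
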